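(* Let $d$ be an integer with $d \geq 2$, let $n = d+2$, let $\tau_1 < \cdots < \tau_n$ be integers, and let $K$ be a field. Let $Q = Q_d(\tau_1,\ldots,\tau_n)$ be the affine semigroup generated by the vectors $(1,\tau_i,\tau_i^2,\ldots,\tau_i^d) \in \mathbb{Z}^{d+1}$, $i=1,\ldots,n$. Then the semigroup $K$-algebra $K[Q]$ is not normal.
   Context: $Q_d(\tau_1,\ldots,\tau_n) = \mathbb{Z}_{\geq 0}\{(1,\tau_i,\tau_i^2,\ldots,\tau_i^d) : i = 1,\ldots,n\}$ is the additive submonoid of $\mathbb{Z}^{d+1}$ generated by the listed vectors. $K[Q]$ is the $K$-algebra with $K$-basis the monomials $t^{\mathbf{a}} = t_0^{a_0}t_1^{a_1}\cdots t_d^{a_d}$, $\mathbf{a} \in Q$, and multiplication $t^{\mathbf{a}}t^{\mathbf{b}} = t^{\mathbf{a}+\mathbf{b}}$. Normal means integrally closed in its field of fractions. *)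

theory Defs
  imports
    "HOL-Library.Poly_Mapping"
    "HOL-Computational_Algebra.Polynomial_Factorial"
begin

inductive_set submonoid_generated :: "'a::monoid_add set \<Rightarrow> 'a set" for S where
  zero: "0 \<in> submonoid_generated S"
| gen: "a \<in> S \<Longrightarrow> a \<in> submonoid_generated S"
| add: "a \<in> submonoid_generated S \<Longrightarrow> b \<in> submonoid_generated S \<Longrightarrow> a + b \<in> submonoid_generated S"

text \<open>
  The lattice of integer vectors \<open>(a\<^sub>0, \<dots>, a\<^sub>d)\<close> is represented inside \<open>nat \<Rightarrow>\<^sub>0 int\<close>
  as the vectors supported on \<open>{..d}\<close>, so that the dimension can be an ordinary variable.
  Since \<open>x ^ 0 = 1\<close> for every \<open>x\<close>, also for \<open>x = 0\<close>, the zeroth coordinate of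
  \<open>moment_vector d x\<close> is always 1.
\<close>

definition moment_vector :: "nat \<Rightarrow> int \<Rightarrow> (nat \<Rightarrow>\<^sub>0 int)" where
  "moment_vector d x = (\<Sum>j\<le>d. Poly_Mapping.single j (x ^ j))"

lemma lookup_moment_vector:
  "Poly_Mapping.lookup (moment_vector d x) j = (if j \<le> d then x ^ j else 0)"
  by (simp add: moment_vector_def lookup_sum lookup_single when_def)

definition moment_semigroup :: "nat \<Rightarrow> nat \<Rightarrow> (nat \<Rightarrow> int) \<Rightarrow> (nat \<Rightarrow>\<^sub>0 int) set" where
  "moment_semigroup d n \<tau> = submonoid_generated ((\<lambda>i. moment_vector d (\<tau> i)) ` {1..n})"

text \<open>
  The type \<open>'g \<Rightarrow>\<^sub>0 'k\<close> with its convolution product is the monoid algebra of \<open>'g\<close> over \<open>'k\<close>;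
  the monomial \<open>t\<^sup>a\<close> is \<open>Poly_Mapping.single a 1\<close>. The algebra of a submonoid \<open>Q\<close> is the subring
  of elements that are combinations of the monomials \<open>t\<^sup>a\<close> with \<open>a \<in> Q\<close>.
\<close>

definition semigroup_algebra :: "'g::monoid_add set \<Rightarrow> ('g \<Rightarrow>\<^sub>0 'k::field) set" where
  "semigroup_algebra Q = {f. Poly_Mapping.keys f \<subseteq> Q}"

lemma semigroup_algebra_subring:
  fixes S :: "'g::monoid_add set"
  defines "A \<equiv> semigroup_algebra (submonoid_generated S) :: ('g \<Rightarrow>\<^sub>0 'k::field) set"
  shows "0 \<in> A" "1 \<in> A"
    and "f \<in> A \<Longrightarrow> g \<in> A \<Longrightarrow> f - g \<in> A"
    and "f \<in> A \<Longrightarrow> g \<in> A \<Longrightarrow> f * g \<in> A"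
proof -
  show "0 \<in> A" "1 \<in> A"
    by (auto simp: A_def semigroup_algebra_def submonoid_generated.zero)
  show "f - g \<in> A" if "f \<in> A" "g \<in> A"
    using that keys_diff[of f g] by (auto simp: A_def semigroup_algebra_def)
  show "f * g \<in> A" if "f \<in> A" "g \<in> A"
    using that keys_mult[of f g]
    by (fastforce simp: A_def semigroup_algebra_def intro: submonoid_generated.add)
qed

text \<open>
  For a subring \<open>A\<close> of an integral domain, the field of fractions of \<open>A\<close> is taken
  inside the field of fractions of the ambient domain.
\<close>

definition fraction_field_of :: "'a::idom set \<Rightarrow> 'a fract set" where
  "fraction_field_of A = {Fract a b | a b. a \<in> A \<and> b \<in> A \<and> b \<noteq> 0}"

definition integral_over :: "'b::comm_ring_1 set \<Rightarrow> 'b \<Rightarrow> bool" where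
  "integral_over B x \<longleftrightarrow>
     (\<exists>p. lead_coeff p = 1 \<and> (\<forall>i. coeff p i \<in> B) \<and> poly p x = 0)"

definition normal_subring :: "'a::idom set \<Rightarrow> bool" where
  "normal_subring A \<longleftrightarrow>
     (\<forall>x \<in> fraction_field_of A. integral_over (to_fract ` A) x \<longrightarrow> x \<in> to_fract ` A)"

end

theory Submission
  imports Defs
begin

text \<open>
  The integer relations among the \<open>d + 2\<close> moment vectors \<open>v x\<close> are the multiples of one primitive
  relation \<open>u\<close>. If \<open>u a \<ge> 2\<close> and \<open>u b \<le> - 2\<close>, put \<open>m = q - v a - v b\<close>, where \<open>q\<close> is the sum of
  \<open>u x \<cdot> v x\<close> over the \<open>x\<close> with \<open>u x > 0\<close>, or equally of \<open>- u x \<cdot> v x\<close> over those with \<open>u x < 0\<close>.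
  Adding both expressions for \<open>q\<close> shows \<open>2 m \<in> Q\<close>, while primitivity of \<open>u\<close> gives \<open>m \<notin> Q\<close>; so
  \<open>t\<^sup>m\<close> is a fraction that is integral over \<open>K[Q]\<close> but not in it. Such \<open>a\<close> and \<open>b\<close> exist
  because \<open>u\<close> cannot be \<open>-1\<close> on its whole negative part, nor \<open>1\<close> on its whole positive part:
  the products of linear factors over the two parts would be distinct polynomials agreeing to an
  order that their Wronskian rules out.
\<close>

section \<open>Integer relations among moment vectors\<close>

definition moment_relation :: "nat \<Rightarrow> int set \<Rightarrow> (int \<Rightarrow> int) \<Rightarrow> bool" where
  "moment_relation d T u \<longleftrightarrow> (\<forall>k\<le>d. (\<Sum>x\<in>T. u x * x ^ k) = 0)"

lemma moment_relation_uminus: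
  "moment_relation d T u \<Longrightarrow> moment_relation d T (\<lambda>x. - u x)"
  by (simp add: moment_relation_def sum_negf)

lemma moment_relation_diff_mult:
  assumes "moment_relation d T u" "moment_relation d T w"
  shows "moment_relation d T (\<lambda>x. u x - c * w x)"
proof -
  have "(\<Sum>x\<in>T. (u x - c * w x) * x ^ k) = (\<Sum>x\<in>T. u x * x ^ k) - c * (\<Sum>x\<in>T. w x * x ^ k)" for k
    by (simp add: sum_distrib_left algebra_simps flip: sum_subtractf)
  then show ?thesis
    using assms by (simp add: moment_relation_def)
qed

lemma moment_relation_poly:
  assumes "moment_relation d T u" "degree p \<le> d"
  shows "(\<Sum>x\<in>T. u x * poly p x) = 0"
proof -
  have "(\<Sum>x\<in>T. u x * poly p x) = (\<Sum>x\<in>T. \<Sum>k\<le>degree p. coeff p k * (u x * x ^ k))"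
    by (simp add: poly_altdef sum_distrib_left mult_ac)
  also have "\<dots> = (\<Sum>k\<le>degree p. coeff p k * (\<Sum>x\<in>T. u x * x ^ k))"
    by (subst sum.swap) (simp add: sum_distrib_left)
  also have "\<dots> = 0"
    using assms by (simp add: moment_relation_def)
  finally show ?thesis .
qed

section \<open>Products of linear factors, interpolation and the primitive relation\<close>

definition root_prod :: "int set \<Rightarrow> int poly" where
  "root_prod T = (\<Prod>z\<in>T. [:- z, 1:])"

lemma poly_root_prod: "poly (root_prod T) x = (\<Prod>z\<in>T. x - z)"
  by (simp add: root_prod_def poly_prod)

lemma poly_root_prod_eq_0_iff: "finite T \<Longrightarrow> poly (root_prod T) x = 0 \<longleftrightarrow> x \<in> T"
  by (auto simp: poly_root_prod prod_zero_iff)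

lemma degree_root_prod: "finite T \<Longrightarrow> degree (root_prod T) = card T"
  by (simp add: root_prod_def degree_prod_sum_eq)

lemma lead_coeff_root_prod: "lead_coeff (root_prod T) = 1"
  by (simp add: root_prod_def lead_coeff_prod)

lemma root_prod_remove:
  "finite T \<Longrightarrow> x \<in> T \<Longrightarrow> root_prod T = [:- x, 1:] * root_prod (T - {x})"
  by (simp add: root_prod_def prod.remove)

lemma root_prod_Un_disjoint:
  "finite S \<Longrightarrow> finite T \<Longrightarrow> S \<inter> T = {} \<Longrightarrow> root_prod (S \<union> T) = root_prod S * root_prod T"
  by (simp add: root_prod_def prod.union_disjoint)

text \<open>
  The number \<open>poly (root_prod (T - {x})) x\<close> is the derivative of \<open>root_prod T\<close> at \<open>x\<close>.
\<close>

lemma moment_relation_proportional: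
  assumes T: "finite T" "card T = d + 2" and u: "moment_relation d T u"
    and xy: "x \<in> T" "y \<in> T"
  shows "u x * poly (root_prod (T - {x})) x = u y * poly (root_prod (T - {y})) y"
proof (cases "x = y")
  case False
  \<comment> \<open>Pairing \<open>u\<close> with a polynomial that vanishes on \<open>T\<close>
    outside \<open>x\<close> and \<open>y\<close> leaves only two terms.\<close>
  define p where "p = root_prod (T - {x} - {y})"
  have "degree p \<le> d"
    using T xy False by (simp add: p_def degree_root_prod)
  then have "(\<Sum>z\<in>T. u z * poly p z) = 0"
    using u moment_relation_poly by blast
  moreover have "(\<Sum>z\<in>T. u z * poly p z) = u x * poly p x + u y * poly p y"
  proof -
    have "(\<Sum>z\<in>T. u z * poly p z) = (\<Sum>z\<in>{x, y}. u z * poly p z)"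
      using T xy by (intro sum.mono_neutral_right) (auto simp: p_def poly_root_prod_eq_0_iff)
    then show ?thesis using False by simp
  qed
  ultimately have *: "u x * poly p x = - (u y * poly p y)"
    by linarith
  have x: "root_prod (T - {x}) = [:- y, 1:] * p"
    using T xy False unfolding p_def by (intro root_prod_remove) auto
  have "T - {x} - {y} = T - {y} - {x}" by auto
  then have y: "root_prod (T - {y}) = [:- x, 1:] * p"
    using T xy False unfolding p_def by (subst root_prod_remove[of _ x]) auto
  have "u x * poly p x * (x - y) = - (u y * poly p y) * (x - y)"
    by (simp only: *)
  then show ?thesis
    unfolding x y by (simp add: algebra_simps)
qed auto

lemma moment_relation_eq_0:
  assumes T: "finite T" "card T = d + 2" and u: "moment_relation d T u"
    and xy: "x \<in> T" "y \<in> T" and "u x = 0"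
  shows "u y = 0"
  using moment_relation_proportional[OF T u xy] poly_root_prod_eq_0_iff[of "T - {y}" y] T \<open>u x = 0\<close>
  by simp

lemma poly_eq_if_values_eq:
  fixes p q :: "int poly"
  assumes "finite T" "degree p < card T" "degree q < card T"
    and "\<And>x. x \<in> T \<Longrightarrow> poly p x = poly q x"
  shows "p = q"
proof (rule ccontr)
  assume "p \<noteq> q"
  then have "p - q \<noteq> 0" by simp
  have "card T \<le> card {x. poly (p - q) x = 0}"
    using assms(4) by (intro card_mono poly_roots_finite \<open>p - q \<noteq> 0\<close>) auto
  also have "\<dots> \<le> degree (p - q)"
    by (rule card_poly_roots_bound) fact
  also have "\<dots> < card T"
    using assms degree_diff_less[of p "card T" q] by blast
  finally show False by simp
qed

lemma poly_lagrange_sum: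
  assumes "finite T" "x \<in> T"
  shows "poly (\<Sum>z\<in>T. smult (f z) (root_prod (T - {z}))) x = f x * poly (root_prod (T - {x})) x"
proof -
  have "(\<Sum>z\<in>T. f z * poly (root_prod (T - {z})) x)
      = (\<Sum>z\<in>{x}. f z * poly (root_prod (T - {z})) x)"
    using assms by (intro sum.mono_neutral_right) (auto simp: poly_root_prod_eq_0_iff)
  then show ?thesis by (simp add: poly_sum)
qed

lemma degree_lagrange_sum:
  assumes "finite T" "T \<noteq> {}"
  shows "degree (\<Sum>z\<in>T. smult (f z) (root_prod (T - {z}))) < card T"
proof -
  have "degree (\<Sum>z\<in>T. smult (f z) (root_prod (T - {z}))) \<le> card T - 1"
    using assms
    by (intro degree_sum_le order.trans[OF degree_smult_le]) (auto simp: degree_root_prod)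
  then show ?thesis
    using assms card_gt_0_iff[of T] by linarith
qed

text \<open>Up to a common denominator, \<open>u x\<close> is the reciprocal of the derivative of
  \<open>root_prod T\<close> at \<open>x\<close>. Then \<open>L\<close> interpolates a multiple of
  X^k on \<open>d + 2\<close> points, hence equals it, and its coefficient at \<open>d + 1\<close>,
  which is the k-th moment of \<open>u\<close>, vanishes.\<close>

lemma ex_moment_relation:
  assumes T: "finite T" "card T = d + 2"
  shows "\<exists>u. moment_relation d T u \<and> (\<forall>x\<in>T. u x \<noteq> 0)"
proof -
  define w where "w x = poly (root_prod (T - {x})) x" for x
  have w: "w x \<noteq> 0" for x
    using T by (simp add: w_def poly_root_prod_eq_0_iff)
  define u where "u x = (\<Prod>z\<in>T - {x}. w z)" for x
  have uw: "u x * w x = prod w T" if "x \<in> T" for x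
    using T that by (simp add: u_def prod.remove mult.commute)
  have "(\<Sum>x\<in>T. u x * x ^ k) = 0" if "k \<le> d" for k
  proof -
    define L where "L = (\<Sum>x\<in>T. smult (u x * x ^ k) (root_prod (T - {x})))"
    have "L = monom (prod w T) k"
    proof (rule poly_eq_if_values_eq)
      show "degree L < card T"
        unfolding L_def using T by (intro degree_lagrange_sum) auto
      show "degree (monom (prod w T) k) < card T"
        using T that degree_monom_le[of "prod w T" k] by simp
      show "poly L x = poly (monom (prod w T) k) x" if "x \<in> T" for x
        using that T uw[of x] by (simp add: L_def poly_lagrange_sum poly_monom mult_ac flip: w_def)
    qed (use T in auto)
    moreover have "coeff L (d + 1) = (\<Sum>x\<in>T. u x * x ^ k)"
    proof -
      have "coeff (root_prod (T - {x})) (d + 1) = 1" if "x \<in> T" for x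
        using that T lead_coeff_root_prod[of "T - {x}"] by (simp add: degree_root_prod)
      then show ?thesis by (simp add: L_def coeff_sum)
    qed
    ultimately show ?thesis using that by simp
  qed
  moreover have "u x \<noteq> 0" for x
    using T w by (simp add: u_def)
  ultimately show ?thesis
    by (auto simp: moment_relation_def)
qed

text \<open>Fix a point \<open>y\<close> and take \<open>u\<close> with the least positive value
  there. Dividing another relation by \<open>u\<close> leaves a remainder whose value at
  \<open>y\<close> lies below that minimum, hence is zero; and a relation vanishing at one point of
  \<open>T\<close> vanishes on all of it.\<close>

lemma ex_primitive_moment_relation:
  assumes T: "finite T" "card T = d + 2"
  obtains u where "moment_relation d T u" "\<And>x. x \<in> T \<Longrightarrow> u x \<noteq> 0"
    and "\<And>w. moment_relation d T w \<Longrightarrow> \<exists>k. \<forall>x\<in>T. w x = k * u x"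
proof -
  obtain y where y: "y \<in> T" using T by fastforce
  define P where "P m \<longleftrightarrow> (\<exists>u. moment_relation d T u \<and> u y = int m \<and> m > 0)" for m
  obtain u0 where u0: "moment_relation d T u0" "u0 y \<noteq> 0"
    using ex_moment_relation[OF T] y by blast
  have "P (nat \<bar>u0 y\<bar>)"
  proof (cases "u0 y > 0")
    case True
    then show ?thesis using u0 by (auto simp: P_def)
  next
    case False
    then show ?thesis using u0 moment_relation_uminus[OF u0(1)]
      by (auto simp: P_def intro!: exI[of _ "\<lambda>x. - u0 x"])
  qed
  then have "P (LEAST m. P m)" by (rule LeastI)
  then obtain u where u: "moment_relation d T u" "u y = int (LEAST m. P m)" "u y > 0"
    by (auto simp: P_def)
  show ?thesis
  proof
    show "moment_relation d T u" by fact
    show "u x \<noteq> 0" if "x \<in> T" for x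
      using moment_relation_eq_0[OF T u(1) that y] u(3) by auto
    show "\<exists>k. \<forall>x\<in>T. w x = k * u x" if w: "moment_relation d T w" for w
    proof -
      define k where "k = w y div u y"
      define r where "r x = w x - k * u x" for x
      have r: "moment_relation d T r"
        unfolding r_def using w u(1) by (rule moment_relation_diff_mult)
      have ry: "r y = w y mod u y"
        by (simp add: r_def k_def minus_div_mult_eq_mod)
      have "r y = 0"
      proof (rule ccontr)
        assume "r y \<noteq> 0"
        moreover have "0 \<le> r y" "r y < u y" using u(3) by (simp_all add: ry)
        ultimately have "P (nat (r y))" using r by (auto simp: P_def)
        then have "(LEAST m. P m) \<le> nat (r y)" by (rule Least_le)
        then show False using \<open>r y < u y\<close> \<open>0 \<le> r y\<close> u(2) by linarith
      qed
      then have "r x = 0" if "x \<in> T" for x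
        using moment_relation_eq_0[OF T r y that] by simp
      then show ?thesis by (auto simp: r_def intro!: exI[of _ k])
    qed
  qed
qed

section \<open>Sizes of the positive and negative values of a relation\<close>

text \<open>
  The coefficient at \<open>degree f + degree h - 1\<close> of the Wronskian is
  \<open>(degree h - degree f)\<close> times the product of the leading coefficients.
\<close>

lemma degree_wronskian_ge:
  fixes f h :: "int poly"
  assumes "h \<noteq> 0" "degree h < degree f"
  shows "degree f - 1 \<le> degree (f * pderiv h - pderiv f * h)"
proof -
  define s e where "s = degree f" and "e = degree h"
  have "coeff (pderiv f * h) (s - 1 + e) = coeff (pderiv f) (s - 1) * coeff h e"
    using coeff_mult_degree_sum[of "pderiv f" h] by (simp add: degree_pderiv s_def e_def)
  also have "\<dots> = int s * (coeff f s * coeff h e)"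
    using assms by (simp add: coeff_pderiv s_def)
  finally have 1: "coeff (pderiv f * h) (s - 1 + e) = int s * (coeff f s * coeff h e)" .
  have 2: "coeff (f * pderiv h) (s - 1 + e) = int e * (coeff f s * coeff h e)"
  \<comment> \<open>Constant \<open>h\<close> is treated apart because \<open>e - 1\<close> would be
    truncated.\<close>
  proof (cases "e = 0")
    case True
    then have "pderiv h = 0" by (simp add: pderiv_eq_0_iff e_def)
    then show ?thesis using True by simp
  next
    case False
    have "coeff (f * pderiv h) (s + (e - 1)) = coeff f s * coeff (pderiv h) (e - 1)"
      using coeff_mult_degree_sum[of f "pderiv h"] by (simp add: degree_pderiv s_def e_def)
    also have "s + (e - 1) = s - 1 + e"
      using False assms by (simp add: s_def)
    finally show ?thesis using False by (simp add: coeff_pderiv)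
  qed
  have "coeff (f * pderiv h - pderiv f * h) (s - 1 + e) = (int e - int s) * (coeff f s * coeff h e)"
    unfolding coeff_diff 1 2 by (simp add: algebra_simps)
  also have "\<dots> \<noteq> 0"
    using assms by (auto simp: s_def e_def)
  finally have "s - 1 + e \<le> degree (f * pderiv h - pderiv f * h)"
    by (rule le_degree)
  then show ?thesis by (simp add: s_def)
qed

text \<open>Test the relation against (X - b)^2, which \<open>d \<ge> 2\<close> allows: if no point
  other than \<open>b\<close> carries a positive value, all terms have the same sign, so each
  vanishes and \<open>T\<close> has at most one point.\<close>

lemma two_le_card_pos_support:
  assumes T: "finite T" "card T = d + 2" and "d \<ge> 2"
    and u: "moment_relation d T u" "\<And>x. x \<in> T \<Longrightarrow> u x \<noteq> 0"
  shows "2 \<le> card {x \<in> T. u x > 0}"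
proof (rule ccontr)
  assume "\<not> 2 \<le> card {x \<in> T. u x > 0}"
  then have "card {x \<in> T. u x > 0} \<le> Suc 0" by simp
  then have "\<forall>x\<in>{x \<in> T. u x > 0}. \<forall>y\<in>{x \<in> T. u x > 0}. x = y"
    using T by (subst (asm) card_le_Suc0_iff_eq) simp_all
  then obtain b where b: "{x \<in> T. u x > 0} \<subseteq> {b}" by blast
  have "degree ([:- b, 1:] ^ 2) \<le> d"
    using \<open>d \<ge> 2\<close> by (simp add: degree_power_eq)
  from moment_relation_poly[OF u(1) this]
  have "(\<Sum>x\<in>T. - u x * (x - b)\<^sup>2) = 0"
    by (simp add: sum_negf poly_power)
  moreover have "0 \<le> - u x * (x - b)\<^sup>2" if "x \<in> T" for x
    using b that by (cases "x = b") (auto simp: mult_le_0_iff)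
  ultimately have "\<forall>x\<in>T. - u x * (x - b)\<^sup>2 = 0"
    using T by (subst (asm) sum_nonneg_eq_0_iff) auto
  then have "T \<subseteq> {b}" using u(2) by auto
  then have "card T \<le> card {b}" by (intro card_mono) auto
  then show False using T by simp
qed

text \<open>
  If all negative values are \<open>-1\<close>, put \<open>F = \<Prod>(X - x)\<close> over the points with \<open>u x < 0\<close> and
  \<open>G = \<Prod>(X - x) ^ u x\<close> over those with \<open>u x > 0\<close>. The vanishing moments make
  \<open>G' / G - F' / F\<close> a constant multiple of \<open>1 / root_prod T\<close>, so that \<open>F G' - F' G\<close> has
  smaller degree than the Wronskian of two distinct monic polynomials of the same degree can have.
\<close>

lemma moment_relation_ex_le_minus_2:
  assumes T: "finite T" "card T = d + 2" and d: "d \<ge> 2"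
    and u: "moment_relation d T u" "\<And>x. x \<in> T \<Longrightarrow> u x \<noteq> 0"
  shows "\<exists>b\<in>T. u b \<le> - 2"
proof (rule ccontr)
  assume *: "\<not> ?thesis"
  define P N where "P = {x \<in> T. u x > 0}" and "N = {x \<in> T. u x < 0}"
  have fin: "finite P" "finite N" and disj: "P \<inter> N = {}" and TPN: "T = P \<union> N"
    using T u(2) by (auto simp: P_def N_def neq_iff)
  have uN: "u x = - 1" if "x \<in> N" for x
    using * that by (force simp: N_def)
  have cP: "2 \<le> card P"
    unfolding P_def using two_le_card_pos_support[OF T d u] .
  define lin where "lin x = [:- x, 1:]" for x :: int
  define F where "F = root_prod N"
  define G where "G = (\<Prod>x\<in>P. lin x ^ nat (u x))"
  \<comment> \<open>Each root of \<open>G\<close> loses one multiplicity in \<open>G1\<close>, so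
    \<open>G1\<close> divides both \<open>G\<close> and its derivative.\<close>
  define G1 where "G1 = (\<Prod>x\<in>P. lin x ^ (nat (u x) - 1))"
  have lin0: "lin x \<noteq> 0" and dlin: "degree (lin x ^ k) = k" for x k
    by (simp_all add: lin_def degree_power_eq)
  have G_split: "G = root_prod P * G1"
    unfolding G_def G1_def root_prod_def prod.distrib[symmetric]
    by (intro prod.cong) (auto simp: P_def lin_def power_eq_if)
  \<comment> \<open>The zeroth moment makes the monic polynomials \<open>F\<close> and
    \<open>G\<close> equal in degree.\<close>
  have "(\<Sum>x\<in>T. u x) = 0"
    using u(1) by (auto simp: moment_relation_def dest: spec[of _ 0])
  moreover have "(\<Sum>x\<in>T. u x) = (\<Sum>x\<in>P. int (nat (u x))) - int (card N)"
    unfolding TPN using fin disj uN by (simp add: sum.union_disjoint) (simp add: P_def)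
  ultimately have sumP: "(\<Sum>x\<in>P. nat (u x)) = card N"
    by (simp only: flip: of_nat_sum)
  have degG: "degree G = card N"
    unfolding G_def using lin0 by (subst degree_prod_sum_eq) (auto simp: dlin sumP)
  have degF: "degree F = card N"
    using fin by (simp add: F_def degree_root_prod)
  have degG1: "degree G1 + card P = card N"
  proof -
    have "degree G1 = (\<Sum>x\<in>P. nat (u x) - 1)"
      unfolding G1_def using lin0 by (subst degree_prod_sum_eq) (auto simp: dlin)
    also have "\<dots> + card P = (\<Sum>x\<in>P. nat (u x) - 1 + 1)"
      by (simp only: sum.distrib) simp
    also have "\<dots> = (\<Sum>x\<in>P. nat (u x))"
      by (intro sum.cong) (auto simp: P_def)
    finally show ?thesis using sumP by simp
  qed
  have lcG: "lead_coeff G = 1"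
    by (simp add: G_def lin_def lead_coeff_prod lead_coeff_power)
  \<comment> \<open>\<open>R\<close> is the numerator of the sum of \<open>u x\<close> / (X - x)
    over the common denominator \<open>root_prod T\<close>. It takes the same value at all points of
    \<open>T\<close> and has degree below their number, so it is constant.\<close>
  define R where "R = (\<Sum>x\<in>T. smult (u x) (root_prod (T - {x})))"
  obtain c where R: "R = [:c:]"
  proof -
    obtain y where "y \<in> T" using T by fastforce
    have "R = [:u y * poly (root_prod (T - {y})) y:]"
    proof (rule poly_eq_if_values_eq)
      show "degree R < card T"
        unfolding R_def using T by (intro degree_lagrange_sum) auto
      show "poly R x = poly [:u y * poly (root_prod (T - {y})) y:] x" if "x \<in> T" for x
        using moment_relation_proportional[OF T u(1) that \<open>y \<in> T\<close>] T that
        by (simp add: R_def poly_lagrange_sum)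
    qed (use T in auto)
    then show thesis by (rule that)
  qed
  have pF: "pderiv F = (\<Sum>x\<in>N. root_prod (N - {x}))"
    by (simp add: F_def root_prod_def pderiv_prod pderiv_pCons)
  have pG: "pderiv G = (\<Sum>x\<in>P. smult (u x) (root_prod (P - {x}))) * G1"
  proof -
    have "pderiv G = (\<Sum>x\<in>P. (\<Prod>z\<in>P - {x}. lin z ^ nat (u z)) * pderiv (lin x ^ nat (u x)))"
      unfolding G_def by (rule pderiv_prod)
    also have "\<dots> = (\<Sum>x\<in>P. smult (u x) (root_prod (P - {x})) * G1)"
    proof (intro sum.cong refl)
      fix x assume x: "x \<in> P"
      then have "nat (u x) = Suc (nat (u x) - 1)" by (simp add: P_def)
      then have 1: "pderiv (lin x ^ nat (u x)) = smult (u x) (lin x ^ (nat (u x) - 1))"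
        using x pderiv_power_Suc[of "lin x" "nat (u x) - 1"]
        by (simp add: lin_def pderiv_pCons P_def)
      have 2: "(\<Prod>z\<in>P - {x}. lin z ^ nat (u z))
          = root_prod (P - {x}) * (\<Prod>z\<in>P - {x}. lin z ^ (nat (u z) - 1))"
        unfolding root_prod_def prod.distrib[symmetric]
        by (intro prod.cong) (auto simp: P_def lin_def power_eq_if)
      have 3: "G1 = lin x ^ (nat (u x) - 1) * (\<Prod>z\<in>P - {x}. lin z ^ (nat (u z) - 1))"
        unfolding G1_def using fin x by (simp add: prod.remove)
      show "(\<Prod>z\<in>P - {x}. lin z ^ nat (u z)) * pderiv (lin x ^ nat (u x))
          = smult (u x) (root_prod (P - {x})) * G1"
        unfolding 1 2 3 by (simp add: mult_ac)
    qed
    finally show ?thesis by (simp add: sum_distrib_right)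
  qed
  have "R = (\<Sum>x\<in>P. smult (u x) (root_prod (T - {x}))) + (\<Sum>x\<in>N. smult (u x) (root_prod (T - {x})))"
    unfolding R_def TPN using fin disj by (simp add: sum.union_disjoint)
  also have "(\<Sum>x\<in>P. smult (u x) (root_prod (T - {x})))
      = F * (\<Sum>x\<in>P. smult (u x) (root_prod (P - {x})))"
    unfolding sum_distrib_left
  proof (intro sum.cong refl)
    fix x assume "x \<in> P"
    then have "T - {x} = N \<union> (P - {x})" using TPN disj by auto
    then have "root_prod (T - {x}) = F * root_prod (P - {x})"
      using fin disj by (subst F_def) (auto intro!: root_prod_Un_disjoint)
    then show "smult (u x) (root_prod (T - {x})) = F * smult (u x) (root_prod (P - {x}))"
      by simp
  qed
  also have "(\<Sum>x\<in>N. smult (u x) (root_prod (T - {x}))) = - (pderiv F * root_prod P)"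
    unfolding pF sum_distrib_right sum_negf[symmetric]
  proof (intro sum.cong refl)
    fix x assume x: "x \<in> N"
    then have "T - {x} = (N - {x}) \<union> P" using TPN disj by auto
    then have "root_prod (T - {x}) = root_prod (N - {x}) * root_prod P"
      using fin disj by (auto intro!: root_prod_Un_disjoint)
    then show "smult (u x) (root_prod (T - {x})) = - (root_prod (N - {x}) * root_prod P)"
      using x by (simp add: uN)
  qed
  finally have R_eq: "R = F * (\<Sum>x\<in>P. smult (u x) (root_prod (P - {x}))) + - (pderiv F * root_prod P)" .
  have "R * G1 = F * pderiv G - pderiv F * G"
    unfolding pG unfolding G_split R_eq by (simp add: algebra_simps)
  \<comment> \<open>The Wronskian of \<open>F\<close> with itself is zero, so \<open>G\<close> may
    be replaced by \<open>G - F\<close>, whose degree is smaller than that of \<open>F\<close>, as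
    \<open>degree_wronskian_ge\<close> requires.\<close>
  also have "\<dots> = F * pderiv (G - F) - pderiv F * (G - F)"
    by (simp add: pderiv_diff algebra_simps)
  finally have W: "smult c G1 = F * pderiv (G - F) - pderiv F * (G - F)"
    by (simp add: R)
  have "G - F \<noteq> 0"
  proof
    assume "G - F = 0"
    obtain x where x: "x \<in> P" using cP by fastforce
    then have "poly G x = 0"
      using fin by (simp add: G_split poly_root_prod_eq_0_iff)
    moreover have "poly F x \<noteq> 0"
      using x fin disj by (auto simp: F_def poly_root_prod_eq_0_iff)
    ultimately show False using \<open>G - F = 0\<close> by simp
  qed
  moreover have "degree (G - F) < degree F"
  proof -
    have "degree (G - F) \<noteq> card N"
    proof
      assume "degree (G - F) = card N"
      then have "lead_coeff (G - F) = lead_coeff G - lead_coeff F"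
        by (simp add: degF degG)
      also have "\<dots> = 0" by (simp add: lcG F_def lead_coeff_root_prod)
      finally have "lead_coeff (G - F) = 0" .
      then show False using \<open>G - F \<noteq> 0\<close> leading_coeff_0_iff by blast
    qed
    then show ?thesis
      using degree_diff_le[of G "card N" F] by (simp add: degF degG)
  qed
  \<comment> \<open>This is impossible, since \<open>G1\<close> has degree
    \<open>card N - card P\<close> and \<open>card P\<close> is at least 2.\<close>
  ultimately have "card N - 1 \<le> degree (smult c G1)"
    unfolding W using degree_wronskian_ge[of "G - F" F] by (simp add: degF)
  also have "\<dots> \<le> degree G1" by (rule degree_smult_le)
  finally show False using degG1 cP by linarith
qed

section \<open>Nonnegative combinations of moment vectors\<close>

lemma submonoid_generated_sum:
  fixes f :: "'b \<Rightarrow> 'a::comm_monoid_add"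
  assumes "\<And>x. x \<in> X \<Longrightarrow> f x \<in> submonoid_generated S"
  shows "sum f X \<in> submonoid_generated S"
  using assms
  by (induction X rule: infinite_finite_induct) (auto intro: submonoid_generated.intros)

lemma submonoid_generated_of_nat_mult:
  fixes a :: "'a::semiring_1"
  assumes "a \<in> submonoid_generated S"
  shows "of_nat n * a \<in> submonoid_generated S"
  using assms by (induction n) (auto simp: algebra_simps intro: submonoid_generated.intros)

text \<open>
  Multiplication by an integer in the convolution ring \<open>nat \<Rightarrow>\<^sub>0 int\<close> is the scalar multiplication
  of the lattice.
\<close>

definition moment_comb :: "nat \<Rightarrow> int set \<Rightarrow> (int \<Rightarrow> int) \<Rightarrow> (nat \<Rightarrow>\<^sub>0 int)" where
  "moment_comb d T c = (\<Sum>x\<in>T. of_int (c x) * moment_vector d x)"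

lemma lookup_of_int_mult:
  fixes p :: "nat \<Rightarrow>\<^sub>0 int"
  shows "Poly_Mapping.lookup (of_int c * p) k = c * Poly_Mapping.lookup p k"
  by (induction c rule: int_induct[of _ 0])
    (simp_all add: lookup_add lookup_minus algebra_simps)

lemma moment_relation_iff_moment_comb: "moment_relation d T u \<longleftrightarrow> moment_comb d T u = 0"
proof -
  have "Poly_Mapping.lookup (moment_comb d T u) k = (if k \<le> d then \<Sum>x\<in>T. u x * x ^ k else 0)" for k
    by (simp add: moment_comb_def lookup_sum lookup_of_int_mult lookup_moment_vector)
  then show ?thesis
    by (auto simp: moment_relation_def poly_mapping_eq_iff fun_eq_iff)
qed

lemma moment_comb_add: "moment_comb d T (\<lambda>x. c x + e x) = moment_comb d T c + moment_comb d T e"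
  by (simp add: moment_comb_def sum.distrib algebra_simps)

lemma moment_comb_diff: "moment_comb d T (\<lambda>x. c x - e x) = moment_comb d T c - moment_comb d T e"
  by (simp add: moment_comb_def sum_subtractf algebra_simps)

lemma mem_submonoid_generated_moment_vector_iff:
  assumes "finite T"
  shows "m \<in> submonoid_generated (moment_vector d ` T)
    \<longleftrightarrow> (\<exists>c. (\<forall>x. 0 \<le> c x) \<and> m = moment_comb d T c)"
proof
  assume "m \<in> submonoid_generated (moment_vector d ` T)"
  then show "\<exists>c. (\<forall>x. 0 \<le> c x) \<and> m = moment_comb d T c"
  proof induction
    case zero
    then show ?case by (auto simp: moment_comb_def intro!: exI[of _ "\<lambda>_. 0"])
  next
    case (gen a)
    then obtain y where y: "y \<in> T" "a = moment_vector d y" by auto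
    have "moment_comb d T (\<lambda>x. if x = y then 1 else 0)
        = (\<Sum>x\<in>T. if x = y then moment_vector d y else 0)"
      unfolding moment_comb_def by (intro sum.cong) auto
    then have "a = moment_comb d T (\<lambda>x. if x = y then 1 else 0)"
      using y assms by simp
    then show ?case by (intro exI[of _ "\<lambda>x. if x = y then 1 else 0"]) auto
  next
    case (add a b)
    then obtain c e where "\<forall>x. 0 \<le> c x" "a = moment_comb d T c"
      "\<forall>x. 0 \<le> e x" "b = moment_comb d T e" by auto
    then show ?case
      by (intro exI[of _ "\<lambda>x. c x + e x"]) (simp add: moment_comb_add)
  qed
next
  assume "\<exists>c. (\<forall>x. 0 \<le> c x) \<and> m = moment_comb d T c"
  then obtain c where c: "\<And>x. 0 \<le> c x" "m = moment_comb d T c" by auto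
  have "of_int (c x) * moment_vector d x \<in> submonoid_generated (moment_vector d ` T)"
    if "x \<in> T" for x
  proof -
    have "of_int (c x) = (of_nat (nat (c x)) :: nat \<Rightarrow>\<^sub>0 int)"
      using c(1)[of x] by simp
    then show ?thesis
      using that
      by (simp only:) (blast intro: submonoid_generated_of_nat_mult submonoid_generated.gen)
  qed
  then show "m \<in> submonoid_generated (moment_vector d ` T)"
    unfolding c(2) moment_comb_def by (rule submonoid_generated_sum)
qed

section \<open>Failure of normality\<close>

text \<open>The monomial t^m is the quotient of t^(m + b) by t^b and a root of Y^2 - t^(m + m), yet
  lies outside the algebra. The linear order on exponents makes the ambient monoid algebra an
  integral domain.\<close>

lemma not_normal_semigroup_algebra:
  fixes S :: "'g::{ordered_cancel_comm_monoid_add, linorder} set"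
  defines "Q \<equiv> submonoid_generated S"
  assumes "b \<in> Q" "m + b \<in> Q" "m + m \<in> Q" "m \<notin> Q"
  shows "\<not> normal_subring (semigroup_algebra Q :: ('g \<Rightarrow>\<^sub>0 'k::field) set)"
proof
  define A where "A = (semigroup_algebra Q :: ('g \<Rightarrow>\<^sub>0 'k) set)"
  define X where "X a = (Poly_Mapping.single a 1 :: 'g \<Rightarrow>\<^sub>0 'k)" for a
  have X_mult: "X (a + c) = X a * X c" for a c
    by (simp add: X_def mult_single)
  have X_mem: "X a \<in> A \<longleftrightarrow> a \<in> Q" for a
    by (simp add: X_def A_def semigroup_algebra_def)
  have X_nz: "X a \<noteq> 0" for a
    by (metis X_def lookup_single_eq lookup_zero one_neq_zero)
  have subring: "0 \<in> A" "1 \<in> A" "\<And>f g. f \<in> A \<Longrightarrow> g \<in> A \<Longrightarrow> f - g \<in> A"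
    unfolding A_def Q_def by (rule semigroup_algebra_subring; assumption)+
  assume "normal_subring (semigroup_algebra Q :: ('g \<Rightarrow>\<^sub>0 'k) set)"
  then have normal: "normal_subring A" by (simp add: A_def)
  have "to_fract (X m) = Fract (X (m + b)) (X b)"
    using X_nz[of b] by (simp add: to_fract_def eq_fract X_mult)
  then have "to_fract (X m) \<in> fraction_field_of A"
    using assms X_mem X_nz unfolding fraction_field_of_def by blast
  moreover have "integral_over (to_fract ` A) (to_fract (X m))"
    unfolding integral_over_def
  proof (intro exI conjI allI)
    let ?p = "[:to_fract (- X (m + m)), 0, 1:] :: ('g \<Rightarrow>\<^sub>0 'k) fract poly"
    show "lead_coeff ?p = 1" by simp
    have "- X (m + m) \<in> A"
      using subring(3)[OF subring(1), of "X (m + m)"] assms X_mem by simp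
    moreover have "0 \<in> to_fract ` A" "1 \<in> to_fract ` A"
      using subring by (force intro: image_eqI[of _ _ 0], force intro: image_eqI[of _ _ 1])
    ultimately show "coeff ?p i \<in> to_fract ` A" for i
      by (auto simp: coeff_pCons simp del: to_fract_uminus split: nat.split)
    show "poly ?p (to_fract (X m)) = 0"
      by (simp add: X_mult)
  qed
  ultimately have "to_fract (X m) \<in> to_fract ` A"
    using normal by (auto simp: normal_subring_def)
  then show False
    using \<open>m \<notin> Q\<close> X_mem by (auto simp: to_fract_eq_iff)
qed

theorem theorem4p3:
  fixes d n :: nat and \<tau> :: "nat \<Rightarrow> int"
  assumes "d \<ge> 2" and "n = d + 2"
    and "strict_mono_on {1..n} \<tau>"
  shows "\<not> normal_subring
           (semigroup_algebra (moment_semigroup d n \<tau>) :: ((nat \<Rightarrow>\<^sub>0 int) \<Rightarrow>\<^sub>0 'k::field) set)"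
proof -
  define T where "T = \<tau> ` {1..n}"
  have T: "finite T" "card T = d + 2"
    using assms strict_mono_on_imp_inj_on[OF assms(3)] by (auto simp: T_def card_image)
  have Q: "moment_semigroup d n \<tau> = submonoid_generated (moment_vector d ` T)"
    by (simp add: moment_semigroup_def T_def image_image)
  note mem = mem_submonoid_generated_moment_vector_iff[OF T(1)]
  obtain u where u: "moment_relation d T u" "\<And>x. x \<in> T \<Longrightarrow> u x \<noteq> 0"
    and prim: "\<And>w. moment_relation d T w \<Longrightarrow> \<exists>k. \<forall>x\<in>T. w x = k * u x"
    using ex_primitive_moment_relation[OF T] by blast
  obtain b where b: "b \<in> T" "u b \<le> - 2"
    using moment_relation_ex_le_minus_2[OF T assms(1) u] by blast
  obtain a where a: "a \<in> T" "u a \<ge> 2"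
    using moment_relation_ex_le_minus_2[OF T assms(1) moment_relation_uminus[OF u(1)]] u(2) by force
  \<comment> \<open>\<open>moment_comb d T e\<close> is v a + v b; it also serves as the exponent of
    the denominator in the fraction for t^m.\<close>
  define e where "e x = (if x = a \<or> x = b then 1 else 0 :: int)" for x
  define m where "m = moment_comb d T (\<lambda>x. max (u x) 0 - e x)"
  have u0: "moment_comb d T u = 0"
    using u(1) by (simp add: moment_relation_iff_moment_comb)
  show ?thesis
    unfolding Q
  proof (rule not_normal_semigroup_algebra)
    show "moment_comb d T e \<in> submonoid_generated (moment_vector d ` T)"
      unfolding mem by (intro exI[of _ e]) (auto simp: e_def)
    have "m + moment_comb d T e = moment_comb d T (\<lambda>x. max (u x) 0)"
      by (simp add: m_def moment_comb_diff)
    then show "m + moment_comb d T e \<in> submonoid_generated (moment_vector d ` T)"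
      unfolding mem by (intro exI[of _ "\<lambda>x. max (u x) 0"]) auto
    \<comment> \<open>Subtracting the zero combination \<open>u\<close> turns twice
      \<open>max (u x) 0\<close> into \<open>\<bar>u x\<bar>\<close>, which is at least 2 at
      \<open>a\<close> and \<open>b\<close> and so absorbs \<open>2 * e x\<close>.\<close>
    have "m + m = m + m - moment_comb d T u"
      by (simp add: u0)
    also have "\<dots> = moment_comb d T (\<lambda>x. (max (u x) 0 - e x) + (max (u x) 0 - e x) - u x)"
      unfolding m_def by (simp only: moment_comb_add moment_comb_diff)
    also have "(\<lambda>x. (max (u x) 0 - e x) + (max (u x) 0 - e x) - u x) = (\<lambda>x. \<bar>u x\<bar> - 2 * e x)"
      by auto
    finally show "m + m \<in> submonoid_generated (moment_vector d ` T)"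
      unfolding mem using a b by (intro exI[of _ "\<lambda>x. \<bar>u x\<bar> - 2 * e x"]) (auto simp: e_def)
    show "m \<notin> submonoid_generated (moment_vector d ` T)"
    proof
      assume "m \<in> submonoid_generated (moment_vector d ` T)"
      then obtain c where c: "\<And>x. 0 \<le> c x" "m = moment_comb d T c"
        unfolding mem by blast
      then have "moment_relation d T (\<lambda>x. max (u x) 0 - e x - c x)"
        by (simp add: moment_relation_iff_moment_comb moment_comb_diff m_def)
      then obtain k where k: "\<And>x. x \<in> T \<Longrightarrow> max (u x) 0 - e x - c x = k * u x"
        using prim by blast
      \<comment> \<open>At \<open>a\<close>, the equation \<open>u a - 1 - c a = k * u a\<close>
        forces \<open>k < 1\<close>; at \<open>b\<close>, \<open>- 1 - c b = k * u b\<close> forces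
        \<open>k > 0\<close>. No integer satisfies both.\<close>
      have "max (u a) 0 = u a" "max (u b) 0 = 0" "e a = 1" "e b = 1"
        using a b by (auto simp: e_def)
      then have "k * u a - u a < 0" "k * u b < 0"
        using k[OF a(1)] k[OF b(1)] c(1)[of a] c(1)[of b] by linarith+
      then have "(k - 1) * u a < 0" "k * u b < 0"
        by (simp_all only: left_diff_distrib mult_1)
      then have "k < 1" "k > 0"
        using a b by (auto simp: mult_less_0_iff)
      then show False by simp
    qed
  qed
qed

end
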